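(* Let $(\mathfrak g,B)$ be a Rota-Baxter Lie algebra of weight $-1$, let $\widetilde B=\mathrm{id}-B$, and let $(\mathfrak g_+,\mathfrak g_-,\rhd,\blacktriangleright)$ be the matched pair of Lie algebras on $(\mathfrak g,B)$. Let $C:\mathfrak g_+\bowtie\mathfrak g_-\to\mathfrak g_+\bowtie\mathfrak g_-$ be given by $$C\big((B(x_1),\widetilde B(x_2))\big)=\big(B(B(x_1)+\widetilde B(x_2)),\ \widetilde B(B(x_1)+\widetilde B(x_2))\big),\qquad \forall x_1,x_2\in\mathfrak g,$$ and let $\mathfrak g_1=\mathrm{Im}\,C$. Define $B_1,\widetilde{B_1}:\mathfrak g_1\to\mathfrak g_1$ by $B_1((x,u))=C((x,0))$ and $\widetilde{B_1}((x,u))=C((0,u))$ for all $(x,u)\in\mathfrak g_1$. Then: (a) $(\mathfrak g_1,B_1)$ is a Rota-Baxter Lie algebra of weight $-1$ that is Rota-Baxter isomorphic to $(\mathfrak g,B)$; (b) $(\mathfrak g_1,\widetilde{B_1})$ is a Rota-Baxter Lie algebra of weight $-1$ that is Rota-Baxter isomorphic to $(\mathfrak g,\widetilde B)$.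
   Context: Lie algebras are over a field $\mathbb K$. A Rota-Baxter operator of weight $\lambda$ on a Lie algebra $\mathfrak g$ is a linear map $B:\mathfrak g\to\mathfrak g$ with $[B(x),B(y)]=B([B(x),y]+[x,B(y)]+\lambda[x,y])$ for all $x,y$; $(\mathfrak g,B)$ is then a Rota-Baxter Lie algebra of weight $\lambda$. A Rota-Baxter Lie algebra homomorphism $f:(\mathfrak g,B)\to(\mathfrak g',B')$ is a Lie algebra homomorphism with $f\circ B=B'\circ f$; two Rota-Baxter Lie algebras are Rota-Baxter isomorphic if there is a bijective such $f$. For $(\mathfrak g,B)$ of weight $-1$ put $\widetilde B=\mathrm{id}-B$ (also a Rota-Baxter operator of weight $-1$), $\mathfrak g_+=\mathrm{Im}\,B$, $\mathfrak g_-=\mathrm{Im}\,\widetilde B$. The matched pair of Lie algebras on $(\mathfrak g,B)$ is $(\mathfrak g_+,\mathfrak g_-,\rhd,\blacktriangleright)$ with the well-defined maps $B(x)\rhd\widetilde B(y)=\widetilde B([B(x),y])$ and $\widetilde B(x)\blacktriangleright B(y)=B([\widetilde B(x),y])$. Its bicrossed product $\mathfrak g_+\bowtie\mathfrak g_-$ is the (external) vector space direct sum $\mathfrak g_+\oplus\mathfrak g_-$ with the Lie bracket $$[(x,u),(y,v)]_{\bowtie}=\big([x,y]+u\blacktriangleright y-v\blacktriangleright x,\ [u,v]+x\rhd v-y\rhd u\big).$$ The map $C$ is an idempotent Lie algebra homomorphism of $\mathfrak g_+\bowtie\mathfrak g_-$, so $\mathfrak g_1$ is a Lie subalgebra of $\mathfrak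 g_+\bowtie\mathfrak g_-$, with the restricted bracket. *)

theory Defs
  imports "HOL-Analysis.Product_Vector"
begin

text \<open>
  A Lie algebra is carried by a subspace \<open>g\<close> of an ambient vector space, which is a type; take
  \<open>g = UNIV\<close> to obtain a Lie algebra on the whole type. All conditions, and all statements about
  maps, are relativised to the carrier, so the values of brackets and operators outside it
  are irrelevant.
\<close>

definition linear_on ::
  "('k \<Rightarrow> 'a \<Rightarrow> 'a) \<Rightarrow> ('k \<Rightarrow> 'b \<Rightarrow> 'b) \<Rightarrow> 'a::plus set \<Rightarrow> ('a \<Rightarrow> 'b::plus) \<Rightarrow> bool"
  where "linear_on s t V f \<longleftrightarrow>
    (\<forall>x\<in>V. \<forall>y\<in>V. f (x + y) = f x + f y) \<and> (\<forall>c. \<forall>x\<in>V. f (s c x) = t c (f x))"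

locale lie_algebra = vector_space scale
  for scale :: "'k::field \<Rightarrow> 'a::ab_group_add \<Rightarrow> 'a" +
  fixes g :: "'a set" and br :: "'a \<Rightarrow> 'a \<Rightarrow> 'a"
  assumes carrier_subspace: "subspace g"
    and br_closed: "\<And>x y. x \<in> g \<Longrightarrow> y \<in> g \<Longrightarrow> br x y \<in> g"
    and br_linear_left: "\<And>y. y \<in> g \<Longrightarrow> linear_on scale scale g (\<lambda>x. br x y)"
    and br_linear_right: "\<And>x. x \<in> g \<Longrightarrow> linear_on scale scale g (\<lambda>y. br x y)"
    and br_self: "\<And>x. x \<in> g \<Longrightarrow> br x x = 0"
    and jacobi: "\<And>x y z. x \<in> g \<Longrightarrow> y \<in> g \<Longrightarrow> z \<in> g \<Longrightarrow>
      br x (br y z) + br y (br z x) + br z (br x y) = 0"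

locale rota_baxter_lie_algebra = lie_algebra scale g br
  for scale :: "'k::field \<Rightarrow> 'a::ab_group_add \<Rightarrow> 'a"
    and g :: "'a set" and br :: "'a \<Rightarrow> 'a \<Rightarrow> 'a" +
  fixes lam :: 'k and B :: "'a \<Rightarrow> 'a"
  assumes op_closed: "\<And>x. x \<in> g \<Longrightarrow> B x \<in> g"
    and op_linear: "linear_on scale scale g B"
    and rota_baxter: "\<And>x y. x \<in> g \<Longrightarrow> y \<in> g \<Longrightarrow>
      br (B x) (B y) = B (br (B x) y + br x (B y) + scale lam (br x y))"

definition lie_hom ::
  "('k \<Rightarrow> 'a \<Rightarrow> 'a) \<Rightarrow> 'a::plus set \<Rightarrow> ('a \<Rightarrow> 'a \<Rightarrow> 'a) \<Rightarrow>
   ('k \<Rightarrow> 'b \<Rightarrow> 'b) \<Rightarrow> 'b::plus set \<Rightarrow> ('b \<Rightarrow> 'b \<Rightarrow> 'b) \<Rightarrow> ('a \<Rightarrow> 'b) \<Rightarrow> bool"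
  where "lie_hom s g br s' g' br' f \<longleftrightarrow>
    f ` g \<subseteq> g' \<and> linear_on s s' g f \<and> (\<forall>x\<in>g. \<forall>y\<in>g. f (br x y) = br' (f x) (f y))"

definition rota_baxter_hom ::
  "('k \<Rightarrow> 'a \<Rightarrow> 'a) \<Rightarrow> 'a::plus set \<Rightarrow> ('a \<Rightarrow> 'a \<Rightarrow> 'a) \<Rightarrow> ('a \<Rightarrow> 'a) \<Rightarrow>
   ('k \<Rightarrow> 'b \<Rightarrow> 'b) \<Rightarrow> 'b::plus set \<Rightarrow> ('b \<Rightarrow> 'b \<Rightarrow> 'b) \<Rightarrow> ('b \<Rightarrow> 'b) \<Rightarrow> ('a \<Rightarrow> 'b) \<Rightarrow> bool"
  where "rota_baxter_hom s g br B s' g' br' B' f \<longleftrightarrow>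
    lie_hom s g br s' g' br' f \<and> (\<forall>x\<in>g. f (B x) = B' (f x))"

definition rota_baxter_isomorphic ::
  "('k \<Rightarrow> 'a \<Rightarrow> 'a) \<Rightarrow> 'a::plus set \<Rightarrow> ('a \<Rightarrow> 'a \<Rightarrow> 'a) \<Rightarrow> ('a \<Rightarrow> 'a) \<Rightarrow>
   ('k \<Rightarrow> 'b \<Rightarrow> 'b) \<Rightarrow> 'b::plus set \<Rightarrow> ('b \<Rightarrow> 'b \<Rightarrow> 'b) \<Rightarrow> ('b \<Rightarrow> 'b) \<Rightarrow> bool"
  where "rota_baxter_isomorphic s g br B s' g' br' B' \<longleftrightarrow>
    (\<exists>f. rota_baxter_hom s g br B s' g' br' B' f \<and> bij_betw f g g')"

definition rb_compl :: "('a \<Rightarrow> 'a) \<Rightarrow> 'a::minus \<Rightarrow> 'a"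
  where "rb_compl B x = x - B x"

text \<open>
  The two actions are given on representatives, \<open>B x \<rhd> B\<^sup>~ y = B\<^sup>~ [B x, y]\<close> and
  \<open>B\<^sup>~ x \<blacktriangleright> B y = B [B\<^sup>~ x, y]\<close>, where \<open>B\<^sup>~\<close> is \<open>rb_compl B\<close>. The description operator picks
  the common value; that it does not depend on the representatives is shown by
  \<open>rb_act_plus_eq\<close> and \<open>rb_act_minus_eq\<close> below. Outside the images the actions are unspecified.
\<close>

definition rb_act_plus ::
  "'a set \<Rightarrow> ('a \<Rightarrow> 'a \<Rightarrow> 'a) \<Rightarrow> ('a \<Rightarrow> 'a) \<Rightarrow> 'a::minus \<Rightarrow> 'a \<Rightarrow> 'a"
  where "rb_act_plus g br B a u =
    (THE w. \<exists>x\<in>g. \<exists>y\<in>g. a = B x \<and> u = rb_compl B y \<and> w = rb_compl B (br (B x) y))"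

definition rb_act_minus ::
  "'a set \<Rightarrow> ('a \<Rightarrow> 'a \<Rightarrow> 'a) \<Rightarrow> ('a \<Rightarrow> 'a) \<Rightarrow> 'a::minus \<Rightarrow> 'a \<Rightarrow> 'a"
  where "rb_act_minus g br B u a =
    (THE w. \<exists>x\<in>g. \<exists>y\<in>g. u = rb_compl B x \<and> a = B y \<and> w = B (br (rb_compl B x) y))"

definition bicrossed_bracket ::
  "('a \<Rightarrow> 'a \<Rightarrow> 'a) \<Rightarrow> ('b \<Rightarrow> 'b \<Rightarrow> 'b) \<Rightarrow> ('a \<Rightarrow> 'b \<Rightarrow> 'b) \<Rightarrow> ('b \<Rightarrow> 'a \<Rightarrow> 'a) \<Rightarrow>
   'a::ab_group_add \<times> 'b::ab_group_add \<Rightarrow> 'a \<times> 'b \<Rightarrow> 'a \<times> 'b"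
  where "bicrossed_bracket br1 br2 act1 act2 = (\<lambda>(x, u) (y, v).
    (br1 x y + act2 u y - act2 v x, br2 u v + act1 x v - act1 y u))"

text \<open>The bracket of the bicrossed product of \<open>B ` g\<close> and \<open>rb_compl B ` g\<close>, whose underlying
  space is \<open>B ` g \<times> rb_compl B ` g\<close> with componentwise operations.\<close>

definition rb_bicrossed_bracket ::
  "'a set \<Rightarrow> ('a \<Rightarrow> 'a \<Rightarrow> 'a) \<Rightarrow> ('a \<Rightarrow> 'a) \<Rightarrow> 'a::ab_group_add \<times> 'a \<Rightarrow> 'a \<times> 'a \<Rightarrow> 'a \<times> 'a"
  where "rb_bicrossed_bracket g br B =
    bicrossed_bracket br br (rb_act_plus g br B) (rb_act_minus g br B)"

lemma linear_on_diff:
  assumes "vector_space s" "module.subspace s V" "linear_on s s V f" "x \<in> V" "y \<in> V"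
  shows "f (x - y) = f x - f y"
proof -
  interpret vector_space s by fact
  have "x - y \<in> V" using assms subspace_diff by blast
  then have "f (x - y + y) = f (x - y) + f y"
    using assms(3,5) unfolding linear_on_def by blast
  then show ?thesis by (simp add: algebra_simps)
qed

lemma rb_act_plus_eq:
  fixes scale :: "'k::field \<Rightarrow> 'a::ab_group_add \<Rightarrow> 'a"
  assumes "rota_baxter_lie_algebra scale g br (- 1) B" and x: "x \<in> g" and y: "y \<in> g"
  shows "rb_act_plus g br B (B x) (rb_compl B y) = rb_compl B (br (B x) y)"
proof -
  interpret rota_baxter_lie_algebra scale g br "- 1" B by fact
  note diff = linear_on_diff[OF vector_space_axioms carrier_subspace]
  have "rb_compl B (br (B x') y') = rb_compl B (br (B x) y)"
    if "x' \<in> g" "y' \<in> g" "B x = B x'" "rb_compl B y = rb_compl B y'" for x' y'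
  proof -
    let ?z = "y - y'"
    have z: "?z \<in> g" using carrier_subspace that y by (simp add: subspace_diff)
    have "?z = (rb_compl B y - rb_compl B y') + (B y - B y')"
      by (simp add: rb_compl_def)
    then have "B ?z = ?z"
      using that diff[OF op_linear y \<open>y' \<in> g\<close>] by simp
    then have "br (B x) ?z = B (br (B x) ?z)"
      using rota_baxter[OF x z] by simp
    moreover have "br (B x) ?z = br (B x) y - br (B x) y'"
      by (rule diff[OF br_linear_right]) (use op_closed x y that in auto)
    moreover have "B (br (B x) y - br (B x) y') = B (br (B x) y) - B (br (B x) y')"
      by (rule diff[OF op_linear]) (use br_closed op_closed x y that in auto)
    ultimately have "br (B x) y - br (B x) y' = B (br (B x) y) - B (br (B x) y')" by simp
    moreover have "rb_compl B (br (B x) y) - rb_compl B (br (B x) y') =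
        (br (B x) y - br (B x) y') - (B (br (B x) y) - B (br (B x) y'))"
      by (simp add: rb_compl_def)
    ultimately have "rb_compl B (br (B x) y) = rb_compl B (br (B x) y')"
      by simp
    then show ?thesis using that by simp
  qed
  then show ?thesis
    unfolding rb_act_plus_def using x y by (intro the_equality) blast+
qed

lemma rb_act_minus_eq:
  fixes scale :: "'k::field \<Rightarrow> 'a::ab_group_add \<Rightarrow> 'a"
  assumes "rota_baxter_lie_algebra scale g br (- 1) B" and x: "x \<in> g" and y: "y \<in> g"
  shows "rb_act_minus g br B (rb_compl B x) (B y) = B (br (rb_compl B x) y)"
proof -
  interpret rota_baxter_lie_algebra scale g br "- 1" B by fact
  note diff = linear_on_diff[OF vector_space_axioms carrier_subspace]
  have cl: "rb_compl B x \<in> g"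
    using x op_closed carrier_subspace by (simp add: rb_compl_def subspace_diff)
  have "B (br (rb_compl B x') y') = B (br (rb_compl B x) y)"
    if "x' \<in> g" "y' \<in> g" "rb_compl B x = rb_compl B x'" "B y = B y'" for x' y'
  proof -
    let ?z = "y - y'"
    have z: "?z \<in> g" using carrier_subspace that y by (simp add: subspace_diff)
    have "B ?z = 0"
      using that diff[OF op_linear y \<open>y' \<in> g\<close>] by simp
    moreover have "br w 0 = 0" if "w \<in> g" for w
      using diff[OF br_linear_right[OF that] that that] by simp
    ultimately have "B (br (B x) ?z - br x ?z) = 0"
      using rota_baxter[OF x z] op_closed x by simp
    moreover have "br (rb_compl B x) ?z = br x ?z - br (B x) ?z"
      unfolding rb_compl_def by (rule diff[OF br_linear_left[OF z]]) (use op_closed x in auto)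
    moreover have "B (br x ?z - br (B x) ?z) = B (br x ?z) - B (br (B x) ?z)"
      "B (br (B x) ?z - br x ?z) = B (br (B x) ?z) - B (br x ?z)"
      by (rule diff[OF op_linear]; use br_closed op_closed x z in auto)+
    ultimately have "B (br (rb_compl B x) ?z) = 0" by simp
    moreover have "br (rb_compl B x) ?z = br (rb_compl B x) y - br (rb_compl B x) y'"
      by (rule diff[OF br_linear_right]) (use cl y that in auto)
    moreover have "B (br (rb_compl B x) y - br (rb_compl B x) y')
        = B (br (rb_compl B x) y) - B (br (rb_compl B x) y')"
      by (rule diff[OF op_linear]) (use br_closed cl y that in auto)
    ultimately show ?thesis using that by simp
  qed
  then show ?thesis
    unfolding rb_act_minus_def using x y by (intro the_equality) blast+
qed

end

theory Submission
  imports Defs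
begin

text \<open>
  Every \<open>z\<close> in \<open>g\<close> splits as \<open>B z + B\<^sup>~ z\<close>, where \<open>B\<^sup>~\<close> is \<open>rb_compl B\<close>. Hence the
  splitting map \<open>\<phi> z = (B z, B\<^sup>~ z)\<close> has addition as a left inverse, and every \<open>z\<close> is a sum
  \<open>B x\<^sub>1 + B\<^sup>~ x\<^sub>2\<close>. Since \<open>C\<close> is addition followed by \<open>\<phi>\<close>, its image is exactly the
  subspace \<open>\<phi> ` g\<close>, and \<open>\<phi>\<close> is a linear bijection from \<open>g\<close> onto it.

  The bicrossed bracket is made so that \<open>\<phi>\<close> respects brackets: in the first component this is
  the identity \<open>[B x, B y] + B [B\<^sup>~ x, y] + B [x, B\<^sup>~ y] = B [x, y]\<close>, a rewriting of the
  Rota-Baxter identity of weight \<open>-1\<close> (\<open>rota_baxter_splitting\<close>), and in the second component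
  it is the same identity for the Rota-Baxter operator \<open>B\<^sup>~\<close>, whose complement is again \<open>B\<close>
  (\<open>splitting_bracket\<close>). Evaluating \<open>C\<close> at \<open>(B z, 0)\<close> and at \<open>(0, B\<^sup>~ z)\<close> gives
  \<open>\<phi> (B z)\<close> and \<open>\<phi> (B\<^sup>~ z)\<close>. So the two operators on the image of \<open>C\<close> are \<open>B\<close> and \<open>B\<^sup>~\<close>
  carried over along \<open>\<phi>\<close>, and both claims are instances of transport of structure
  (\<open>rota_baxter_transport\<close>).
\<close>

lemma rb_compl_rb_compl [simp]: "rb_compl (rb_compl B) = (B :: 'a::ab_group_add \<Rightarrow> 'a)"
  by (simp add: rb_compl_def fun_eq_iff)

lemma (in lie_algebra) br_anti_commute:
  assumes "x \<in> g" "y \<in> g"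
  shows "br x y = - br y x"
proof -
  have s: "x + y \<in> g" using assms carrier_subspace subspace_add by blast
  have "0 = br (x + y) (x + y)" using br_self[OF s] by simp
  also have "\<dots> = br x (x + y) + br y (x + y)"
    using br_linear_left[OF s] assms unfolding linear_on_def by blast
  also have "\<dots> = (br x x + br x y) + (br y x + br y y)"
    using br_linear_right assms unfolding linear_on_def by metis
  also have "\<dots> = br x y + br y x" using br_self assms by simp
  finally show ?thesis by (simp add: eq_neg_iff_add_eq_0)
qed

context
  fixes scale :: "'k::field \<Rightarrow> 'a::ab_group_add \<Rightarrow> 'a" and g br B
  assumes rb: "rota_baxter_lie_algebra scale g br (- 1) B"
begin

interpretation rota_baxter_lie_algebra scale g br "- 1" B by (fact rb)

lemmas carrier_diff = linear_on_diff[OF vector_space_axioms carrier_subspace]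

lemma rb_compl_closed: "x \<in> g \<Longrightarrow> rb_compl B x \<in> g"
  using op_closed carrier_subspace by (simp add: rb_compl_def subspace_diff)

lemma br_rb_compl_left: "x \<in> g \<Longrightarrow> y \<in> g \<Longrightarrow> br (rb_compl B x) y = br x y - br (B x) y"
  unfolding rb_compl_def by (rule carrier_diff[OF br_linear_left]) (auto simp: op_closed)

lemma br_rb_compl_right: "x \<in> g \<Longrightarrow> y \<in> g \<Longrightarrow> br x (rb_compl B y) = br x y - br x (B y)"
  unfolding rb_compl_def by (rule carrier_diff[OF br_linear_right]) (auto simp: op_closed)

lemma op_add:
  "x \<in> g \<Longrightarrow> y \<in> g \<Longrightarrow> B (x + y) = B x + B y"
  using op_linear unfolding linear_on_def by blast

text \<open>
  Expanding \<open>B\<^sup>~ = id - B\<close> in both mixed terms, the Rota-Baxter identity cancels everything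
  except \<open>B [x, y]\<close>. In this form the three summands are the ones that occur in a component of the
  bicrossed bracket.
\<close>

lemma rota_baxter_splitting:
  assumes x: "x \<in> g" and y: "y \<in> g"
  shows "br (B x) (B y) + B (br (rb_compl B x) y) + B (br x (rb_compl B y)) = B (br x y)"
proof -
  note cl = br_closed op_closed x y
  have "br (B x) (B y) = B (br (B x) y + br x (B y) - br x y)"
    using rota_baxter[OF x y] by simp
  also have "\<dots> = B (br (B x) y) + B (br x (B y)) - B (br x y)"
    using carrier_diff[OF op_linear, of "br (B x) y + br x (B y)" "br x y"]
      op_add[of "br (B x) y" "br x (B y)"] cl subspace_add[OF carrier_subspace]
    by simp
  finally have "br (B x) (B y) = B (br (B x) y) + B (br x (B y)) - B (br x y)" .
  moreover have "B (br (rb_compl B x) y) = B (br x y) - B (br (B x) y)"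
    using carrier_diff[OF op_linear] br_rb_compl_left cl by simp
  moreover have "B (br x (rb_compl B y)) = B (br x y) - B (br x (B y))"
    using carrier_diff[OF op_linear] br_rb_compl_right cl by simp
  ultimately show ?thesis by simp
qed

lemma linear_on_rb_compl: "linear_on scale scale g (rb_compl B)"
  using op_linear by (simp add: linear_on_def rb_compl_def scale_right_diff_distrib)

text \<open>
  In terms of \<open>z = [B x, y] + [x, B y] - [x, y]\<close>, the right-hand side of the identity for \<open>B\<^sup>~\<close>
  is \<open>B\<^sup>~ (-z) = B z - z\<close>, and \<open>B z = [B x, B y]\<close>, so the two sides agree after expanding
  \<open>[x - B x, y - B y]\<close>.
\<close>

lemma rota_baxter_rb_compl: "rota_baxter_lie_algebra scale g br (- 1) (rb_compl B)"
proof unfold_locales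
  fix x y assume xy: "x \<in> g" "y \<in> g"
  define z where "z = br (B x) y + br x (B y) - br x y"
  have z: "z \<in> g" unfolding z_def
    using xy br_closed op_closed carrier_subspace by (simp add: subspace_add subspace_diff)
  have Bz: "B z = br (B x) (B y)" using rota_baxter[OF xy] by (simp add: z_def)
  have "br (rb_compl B x) y + br x (rb_compl B y) + scale (- 1) (br x y) = 0 - z"
    using xy by (simp add: br_rb_compl_left br_rb_compl_right z_def algebra_simps)
  moreover have "rb_compl B (0 - z) = rb_compl B 0 - rb_compl B z"
    by (rule carrier_diff[OF linear_on_rb_compl subspace_0[OF carrier_subspace] z])
  moreover have "rb_compl B 0 = 0"
    using carrier_diff[OF linear_on_rb_compl z z] by simp
  moreover have "br (rb_compl B x) (rb_compl B y) = br (B x) (B y) - z"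
    using xy by (simp add: br_rb_compl_left br_rb_compl_right op_closed rb_compl_closed z_def
        algebra_simps)
  ultimately show "br (rb_compl B x) (rb_compl B y) =
      rb_compl B (br (rb_compl B x) y + br x (rb_compl B y) + scale (- 1) (br x y))"
    by (simp add: Bz rb_compl_def)
qed (use rb_compl_closed linear_on_rb_compl in auto)

end

text \<open>
  The splitting map \<open>z \<mapsto> (B z, B\<^sup>~ z)\<close> carries the bracket of \<open>g\<close> to the bicrossed bracket. The
  terms with a minus sign turn into the third summand of \<open>rota_baxter_splitting\<close> by
  antisymmetry.
\<close>

lemma splitting_bracket:
  fixes scale :: "'k::field \<Rightarrow> 'a::ab_group_add \<Rightarrow> 'a"
  assumes rb: "rota_baxter_lie_algebra scale g br (- 1) B" and x: "x \<in> g" and y: "y \<in> g"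
  shows "rb_bicrossed_bracket g br B (B x, rb_compl B x) (B y, rb_compl B y) =
    (B (br x y), rb_compl B (br x y))"
proof -
  interpret rota_baxter_lie_algebra scale g br "- 1" B by fact
  interpret t: rota_baxter_lie_algebra scale g br "- 1" "rb_compl B"
    using rota_baxter_rb_compl[OF rb] .
  have neg: "T (br w u) = - T (br u w)"
    if T: "linear_on scale scale g T" and w: "w \<in> g" and u: "u \<in> g" for T w u
  proof -
    have zero_g: "0 \<in> g" using carrier_subspace subspace_0 by blast
    have "T (br w u) = T (0 - br u w)"
      using br_anti_commute[OF w u] by simp
    also have "\<dots> = T 0 - T (br u w)"
      by (rule carrier_diff[OF rb T zero_g br_closed[OF u w]])
    also have "T 0 = 0"
      using carrier_diff[OF rb T u u] by simp
    finally show ?thesis by simp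
  qed
  have "br (B x) (B y) + B (br (rb_compl B x) y) - B (br (rb_compl B y) x) = B (br x y)"
    using rota_baxter_splitting[OF rb x y] neg[OF op_linear t.op_closed[OF y] x] by simp
  moreover have "br (rb_compl B x) (rb_compl B y) + rb_compl B (br (B x) y)
      - rb_compl B (br (B y) x) = rb_compl B (br x y)"
    using rota_baxter_splitting[OF t.rota_baxter_lie_algebra_axioms x y]
      neg[OF t.op_linear op_closed[OF y] x] by simp
  ultimately show ?thesis
    using x y by (simp add: rb_bicrossed_bracket_def bicrossed_bracket_def
        rb_act_plus_eq[OF rb] rb_act_minus_eq[OF rb])
qed

text \<open>
  Transport of structure. All axioms are relativised to the carrier, so the behaviour of the
  new bracket and of the new operator on the image of \<open>\<phi>\<close> determines everything; the isomorphism
  back to \<open>g\<close> is the inverse of \<open>\<phi>\<close>.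
\<close>

lemma rota_baxter_transport:
  fixes s :: "'k::field \<Rightarrow> 'a::ab_group_add \<Rightarrow> 'a" and s' :: "'k \<Rightarrow> 'b::ab_group_add \<Rightarrow> 'b"
  assumes rb: "rota_baxter_lie_algebra s g br lam B"
    and vs': "vector_space s'"
    and lin: "linear_on s s' g \<phi>" and inj: "inj_on \<phi> g"
    and br': "\<And>x y. x \<in> g \<Longrightarrow> y \<in> g \<Longrightarrow> br' (\<phi> x) (\<phi> y) = \<phi> (br x y)"
    and B': "\<And>x. x \<in> g \<Longrightarrow> B' (\<phi> x) = \<phi> (B x)"
  shows "rota_baxter_lie_algebra s' (\<phi> ` g) br' lam B' \<and>
    rota_baxter_isomorphic s' (\<phi> ` g) br' B' s g br B"
proof
  interpret rota_baxter_lie_algebra s g br lam B by fact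
  interpret V': vector_space s' by fact
  have add: "\<phi> (x + y) = \<phi> x + \<phi> y" if "x \<in> g" "y \<in> g" for x y
    using lin that by (simp add: linear_on_def)
  have scl: "\<phi> (s c x) = s' c (\<phi> x)" if "x \<in> g" for c x
    using lin that by (simp add: linear_on_def)
  have zero_g: "0 \<in> g" and add_g: "\<And>x y. x \<in> g \<Longrightarrow> y \<in> g \<Longrightarrow> x + y \<in> g"
    and scale_g: "\<And>c x. x \<in> g \<Longrightarrow> s c x \<in> g"
    using carrier_subspace by (auto simp: subspace_def)
  have zero: "\<phi> 0 = 0" using add[OF zero_g zero_g] by simp
  note lins = br_linear_left[unfolded linear_on_def] br_linear_right[unfolded linear_on_def]
    op_linear[unfolded linear_on_def]
  note push = add[symmetric] scl[symmetric] br' B' zero_g add_g scale_g br_closed op_closed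
  show "rota_baxter_lie_algebra s' (\<phi> ` g) br' lam B'"
  proof unfold_locales
    show "V'.subspace (\<phi> ` g)"
      unfolding V'.subspace_def
    proof (intro conjI ballI allI)
      show "0 \<in> \<phi> ` g" using zero zero_g by (metis imageI)
    qed (auto simp: push)
    show "linear_on s' s' (\<phi> ` g) (\<lambda>x. br' x y)" if "y \<in> \<phi> ` g" for y
      using that by (auto simp: linear_on_def push lins)
    show "linear_on s' s' (\<phi> ` g) (\<lambda>y. br' x y)" if "x \<in> \<phi> ` g" for x
      using that by (auto simp: linear_on_def push lins)
    show "br' x x = 0" if "x \<in> \<phi> ` g" for x
      using that by (auto simp: push br_self zero)
    show "br' x (br' y z) + br' y (br' z x) + br' z (br' x y) = 0"
      if "x \<in> \<phi> ` g" "y \<in> \<phi> ` g" "z \<in> \<phi> ` g" for x y z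
      using that by (auto simp: push jacobi zero)
    show "linear_on s' s' (\<phi> ` g) B'"
      by (auto simp: linear_on_def push lins)
    show "br' (B' x) (B' y) = B' (br' (B' x) y + br' x (B' y) + s' lam (br' x y))"
      if "x \<in> \<phi> ` g" "y \<in> \<phi> ` g" for x y
      using that by (auto simp: push rota_baxter)
  qed (auto simp: push)
  have inv: "inv_into g \<phi> (\<phi> x) = x" if "x \<in> g" for x
    using inj that by simp
  have "rota_baxter_hom s' (\<phi> ` g) br' B' s g br B (inv_into g \<phi>)"
    by (auto simp: rota_baxter_hom_def lie_hom_def linear_on_def push inv)
  moreover have "bij_betw (inv_into g \<phi>) (\<phi> ` g) g"
    using inj by (simp add: bij_betw_inv_into inj_on_imp_bij_betw)
  ultimately show "rota_baxter_isomorphic s' (\<phi> ` g) br' B' s g br B"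
    unfolding rota_baxter_isomorphic_def by blast
qed

theorem corollary2p14:
  fixes scale :: "'k::field \<Rightarrow> 'a::ab_group_add \<Rightarrow> 'a"
    and g :: "'a set"
    and br :: "'a \<Rightarrow> 'a \<Rightarrow> 'a"
    and B :: "'a \<Rightarrow> 'a"
    and C B1 Bt1 :: "'a \<times> 'a \<Rightarrow> 'a \<times> 'a"
    and g1 :: "('a \<times> 'a) set"
  assumes "rota_baxter_lie_algebra scale g br (- 1) B"
    and "\<And>x1 x2. x1 \<in> g \<Longrightarrow> x2 \<in> g \<Longrightarrow>
      C (B x1, rb_compl B x2) = (B (B x1 + rb_compl B x2), rb_compl B (B x1 + rb_compl B x2))"
    and "g1 = C ` (B ` g \<times> rb_compl B ` g)"
    and "\<And>x u. (x, u) \<in> g1 \<Longrightarrow> B1 (x, u) = C (x, 0)"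
    and "\<And>x u. (x, u) \<in> g1 \<Longrightarrow> Bt1 (x, u) = C (0, u)"
  shows "(rota_baxter_lie_algebra (module_prod.scale scale scale) g1
            (rb_bicrossed_bracket g br B) (- 1) B1 \<and>
          rota_baxter_isomorphic (module_prod.scale scale scale) g1
            (rb_bicrossed_bracket g br B) B1 scale g br B) \<and>
         (rota_baxter_lie_algebra (module_prod.scale scale scale) g1
            (rb_bicrossed_bracket g br B) (- 1) Bt1 \<and>
          rota_baxter_isomorphic (module_prod.scale scale scale) g1
            (rb_bicrossed_bracket g br B) Bt1 scale g br (rb_compl B))"
proof -
  interpret rota_baxter_lie_algebra scale g br "- 1" B by fact
  interpret t: rota_baxter_lie_algebra scale g br "- 1" "rb_compl B"
    using rota_baxter_rb_compl[OF assms(1)] .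
  interpret P: vector_space_prod scale scale ..
  define \<phi> where "\<phi> z = (B z, rb_compl B z)" for z
  have zero_g: "0 \<in> g" using carrier_subspace subspace_0 by blast
  have B0: "B 0 = 0" using carrier_diff[OF assms(1) op_linear zero_g zero_g] by simp
  then have Bt0: "rb_compl B 0 = 0" by (simp add: rb_compl_def)
  have split: "B z + rb_compl B z = z" for z by (simp add: rb_compl_def)
  have C: "C (B x1, rb_compl B x2) = \<phi> (B x1 + rb_compl B x2)" if "x1 \<in> g" "x2 \<in> g" for x1 x2
    using assms(2)[OF that] by (simp add: \<phi>_def)
  have g1: "g1 = \<phi> ` g"
  proof
    show "g1 \<subseteq> \<phi> ` g"
      using C op_closed t.op_closed subspace_add[OF carrier_subspace] by (auto simp: assms(3))
    show "\<phi> ` g \<subseteq> g1"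
    proof
      fix p assume "p \<in> \<phi> ` g"
      then obtain z where z: "z \<in> g" "p = \<phi> z" by blast
      then have "p = C (B z, rb_compl B z)" using C split by simp
      then show "p \<in> g1" using z unfolding assms(3) by blast
    qed
  qed
  have lin: "linear_on scale P.scale g \<phi>"
    using op_linear t.op_linear by (simp add: linear_on_def \<phi>_def P.scale_def)
  have inj: "inj_on \<phi> g"
    by (rule inj_on_inverseI[where g = "\<lambda>(x, u). x + u"]) (simp add: \<phi>_def split)
  have br1: "rb_bicrossed_bracket g br B (\<phi> x) (\<phi> y) = \<phi> (br x y)"
    if "x \<in> g" "y \<in> g" for x y
    using splitting_bracket[OF assms(1) that] by (simp add: \<phi>_def)
  have mem: "(B z, rb_compl B z) \<in> g1" if "z \<in> g" for z
    using that by (auto simp: g1 \<phi>_def)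
  \<comment> \<open>The zero components are the values of \<open>rb_compl B\<close> and \<open>B\<close> at \<open>0\<close>, which brings the
    arguments of \<open>C\<close> into the form for which \<open>C\<close> is specified.\<close>
  have B1: "B1 (\<phi> z) = \<phi> (B z)" if "z \<in> g" for z
    using assms(4)[OF mem[OF that]] C[OF that zero_g] by (simp add: Bt0 \<phi>_def)
  have Bt1: "Bt1 (\<phi> z) = \<phi> (rb_compl B z)" if "z \<in> g" for z
    using assms(5)[OF mem[OF that]] C[OF zero_g that] by (simp add: B0 \<phi>_def)
  show ?thesis
    unfolding g1
    using rota_baxter_transport[OF assms(1) P.p.vector_space_axioms lin inj br1 B1]
      rota_baxter_transport[OF t.rota_baxter_lie_algebra_axioms P.p.vector_space_axioms
        lin inj br1 Bt1]
    by blast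
qed

end
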